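(* Let $i\ge 0$ be an integer, let $j,n\in\mathbb{N}$, and let $q$ be an odd prime such that $q-1\nmid n$ and $q^i\mid n$. Then $S_n(q^j)\equiv 0\pmod{q^{i+j}}$, where $S_n(m)=\sum_{r=1}^m r^n$.
   Context: $\mathbb{N}$ denotes the positive integers. $S_n(m)=1^n+2^n+\dots+m^n$. *)

theory Defs
  imports "HOL-Number_Theory.Number_Theory"
begin

definition power_sum :: "nat \<Rightarrow> nat \<Rightarrow> nat" where
  "power_sum n m = (\<Sum>r = 1..m. r ^ n)"

end

theory Submission
  imports Defs
begin

text \<open>
  If \<open>q ^ i\<close> divides \<open>n\<close>, the residue of \<open>r ^ n\<close> modulo \<open>q ^ (i + j)\<close> depends only on \<open>r\<close>
  modulo \<open>q ^ j\<close>. Multiplication by a primitive root \<open>g\<close> modulo \<open>q\<close> permutes the residues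
  modulo \<open>q ^ j\<close>, so the power sum \<open>S\<close> satisfies \<open>g ^ n * S \<equiv> S\<close> modulo \<open>q ^ (i + j)\<close>, and
  \<open>g ^ n - 1\<close> is invertible modulo \<open>q\<close> because \<open>q - 1\<close> does not divide \<open>n\<close>.
\<close>

text \<open>The cofactor of \<open>a - b\<close> in \<open>a ^ q - b ^ q\<close> is a sum of
  \<open>q\<close> terms. As \<open>j \<ge> 1\<close> gives \<open>a \<equiv> b\<close> modulo
  \<open>q\<close>, each term is \<open>b ^ (q - 1)\<close> modulo \<open>q\<close>, so the cofactor
  supplies one more factor \<open>q\<close>.\<close>

lemma cong_power_lift:
  fixes a b :: int and q j :: nat
  assumes "j \<ge> 1" and "[a = b] (mod int q ^ j)"
  shows "[a ^ q = b ^ q] (mod int q ^ Suc j)"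
proof -
  have "[a = b] (mod int q)"
    using assms by (auto intro: cong_dvd_modulus dvd_power)
  then have "[(\<Sum>k<q. b ^ (q - Suc k) * a ^ k) = (\<Sum>k<q. b ^ (q - Suc k) * b ^ k)] (mod int q)"
    by (intro cong_sum cong_mult cong_pow cong_refl)
  also have "(\<Sum>k<q. b ^ (q - Suc k) * b ^ k) = (\<Sum>k<q. b ^ (q - 1))"
    by (intro sum.cong) (auto simp flip: power_add)
  also have "[\<dots> = 0] (mod int q)"
    by (simp add: cong_0_iff)
  finally have "int q dvd (\<Sum>k<q. b ^ (q - Suc k) * a ^ k)"
    by (simp add: cong_0_iff)
  moreover have "int q ^ j dvd a - b"
    using assms(2) by (simp add: cong_iff_dvd_diff)
  ultimately have "int q ^ j * int q dvd (a - b) * (\<Sum>k<q. b ^ (q - Suc k) * a ^ k)"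
    by (rule mult_dvd_mono[rotated])
  then show ?thesis
    by (simp add: cong_iff_dvd_diff power_diff_sumr2 mult.commute)
qed

lemma cong_power_lift_iterated:
  fixes a b :: int and q i j :: nat
  assumes "j \<ge> 1" and "[a = b] (mod int q ^ j)"
  shows "[a ^ (q ^ i) = b ^ (q ^ i)] (mod int q ^ (i + j))"
proof (induction i)
  case 0
  then show ?case using assms by simp
next
  case (Suc i)
  have "[(a ^ (q ^ i)) ^ q = (b ^ (q ^ i)) ^ q] (mod int q ^ Suc (i + j))"
    using assms(1) Suc.IH by (intro cong_power_lift) auto
  then show ?case
    by (simp add: mult.commute flip: power_mult)
qed

lemma cong_power_if_power_dvd_exponent:
  fixes a b q i j n :: nat
  assumes "j \<ge> 1" and "[a = b] (mod q ^ j)" and "q ^ i dvd n"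
  shows "[a ^ n = b ^ n] (mod q ^ (i + j))"
proof -
  obtain k where k: "n = q ^ i * k"
    using assms(3) by blast
  have "[int a = int b] (mod int q ^ j)"
    using assms(2) by (simp flip: cong_int_iff)
  then have "[(int a ^ (q ^ i)) ^ k = (int b ^ (q ^ i)) ^ k] (mod int q ^ (i + j))"
    by (intro cong_pow cong_power_lift_iterated assms(1))
  then show ?thesis
    by (simp add: k power_mult flip: cong_int_iff)
qed

lemma bij_betw_mult_mod:
  fixes g m :: nat
  assumes "coprime g m" and "m > 0"
  shows "bij_betw (\<lambda>r. g * r mod m) {..<m} {..<m}"
proof -
  have "inj_on (\<lambda>r. g * r mod m) {..<m}"
  proof (rule inj_onI)
    fix x y assume "x \<in> {..<m}" "y \<in> {..<m}" "g * x mod m = g * y mod m"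
    then show "x = y"
      using assms(1) by (metis cong_def cong_less_modulus_unique_nat cong_mult_lcancel_nat lessThan_iff)
  qed
  moreover have "(\<lambda>r. g * r mod m) ` {..<m} \<subseteq> {..<m}"
    using assms(2) by auto
  ultimately show ?thesis
    by (simp add: bij_betw_def endo_inj_surj)
qed

text \<open>Trades the range from 1 to \<open>q ^ j\<close> for the standard residues, which
  multiplication by \<open>g\<close> permutes. The top term vanishes by the lifting lemma with
  \<open>b = 0\<close>.\<close>

lemma power_sum_cong_lessThan:
  fixes q i j n :: nat
  assumes "j \<ge> 1" and "n \<ge> 1" and "q ^ i dvd n"
  shows "[power_sum n (q ^ j) = (\<Sum>r<q ^ j. r ^ n)] (mod q ^ (i + j))"
proof -
  have "[(q ^ j) ^ n = 0 ^ n] (mod q ^ (i + j))"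
    using assms by (intro cong_power_if_power_dvd_exponent) (auto simp: cong_0_iff)
  then have "[(\<Sum>r<q ^ j. r ^ n) + (q ^ j) ^ n = (\<Sum>r<q ^ j. r ^ n) + 0 ^ n] (mod q ^ (i + j))"
    by (intro cong_add cong_refl)
  \<comment> \<open>The extra term at \<open>r = 0\<close> is zero because
    \<open>n \<ge> 1\<close>.\<close>
  moreover have "power_sum n (q ^ j) = (\<Sum>r<Suc (q ^ j). r ^ n)"
    unfolding power_sum_def using assms(2)
    by (intro sum.mono_neutral_left) auto
  ultimately show ?thesis
    using assms(2) by (simp add: zero_power)
qed

theorem theorem7:
  fixes i j n q :: nat
  assumes "j \<ge> 1" and "n \<ge> 1"
    and "prime q" and "odd q"
    and "\<not> (q - 1) dvd n"
    and "q ^ i dvd n"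
  shows "[power_sum n (q ^ j) = 0] (mod q ^ (i + j))"
proof -
  define S where "S = (\<Sum>r<q ^ j. r ^ n)"
  have q: "q > 0" using assms(3) prime_gt_0_nat by blast
  obtain g where "residue_primroot q g"
    using prime_primitive_root_exists[of q] assms(3) prime_gt_1_nat by blast
  \<comment> \<open>The order of \<open>g\<close> modulo \<open>q\<close> is \<open>q - 1\<close>,
    which does not divide \<open>n\<close>.\<close>
  then have g: "coprime g q" "\<not> [g ^ n = 1] (mod q)"
    using assms(3,5)
    by (auto simp: residue_primroot_def ord_divides[of g n q] totient_prime coprime_commute
             simp del: One_nat_def)
  have "[g ^ n * S = (\<Sum>r<q ^ j. (g * r mod q ^ j) ^ n)] (mod q ^ (i + j))"
    unfolding S_def sum_distrib_left power_mult_distrib [symmetric]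
    by (intro cong_sum cong_power_if_power_dvd_exponent assms) (simp add: cong_def)
  also have "(\<Sum>r<q ^ j. (g * r mod q ^ j) ^ n) = S"
    unfolding S_def using q g(1)
    by (intro sum.reindex_bij_betw[of _ _ _ "\<lambda>r. r ^ n"] bij_betw_mult_mod) auto
  \<comment> \<open>Over the integers the subtraction is not truncated.\<close>
  finally have "int q ^ (i + j) dvd (int g ^ n - 1) * int S"
    by (simp add: cong_iff_dvd_diff left_diff_distrib flip: cong_int_iff)
  moreover have "\<not> int q dvd int g ^ n - 1"
    using g(2) by (simp add: cong_iff_dvd_diff flip: cong_int_iff)
  \<comment> \<open>Since \<open>q\<close> is prime, non-divisibility by \<open>q\<close> already
    gives coprimality to all its powers, so the factor can be cancelled.\<close>
  then have "coprime (int q ^ (i + j)) (int g ^ n - 1)"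
    using assms(3) by (intro coprime_power_left_iff[THEN iffD2] disjI1 prime_imp_coprime) auto
  ultimately have "int q ^ (i + j) dvd int S"
    by (simp add: coprime_dvd_mult_right_iff)
  then have "[S = 0] (mod q ^ (i + j))"
    by (simp add: cong_0_iff flip: of_nat_power)
  then show ?thesis
    using power_sum_cong_lessThan[OF assms(1,2,6)] cong_trans unfolding S_def by blast
qed

end
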